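(* Let $\Gamma$ be a free group of finite rank at least $2$. Then $\Gamma$ is sharply MIF.
   Context: For a group $\Gamma$, let $\Gamma\ast\mathbb{Z}$ be the free product of $\Gamma$ with an infinite cyclic group $\mathbb{Z}=\langle x\rangle$. For $w\in\Gamma\ast\mathbb{Z}$ and $g\in\Gamma$, let $w(g)\in\Gamma$ be the image of $w$ under the unique homomorphism $\Gamma\ast\mathbb{Z}\to\Gamma$ that is the identity on $\Gamma$ and sends $x$ to $g$. Given a finite generating set $S$ of $\Gamma$, $|\cdot|_S$ denotes word-length on $\Gamma$ with respect to $S$ and $|\cdot|_{S\cup\{x\}}$ denotes word-length on $\Gamma\ast\mathbb{Z}$ with respect to $S\cup\{x\}$. The complexity of $w$ is $\chi_\Gamma^S(w)=\min\{|g|_S : g\in\Gamma,\ w(g)\neq e_\Gamma\}$, with value $+\infty$ if there is no such $g$. The MIF growth function is $$\mathcal{M}_\Gamma^S(n)=\max\{\chi_\Gamma^S(w) : w\in\Gamma\ast\mathbb{Z},\ w\neq e,\ |w|_{S\cup\{x\}}\leq n\}.$$ A finitely generated group $\Gamma$ is sharply MIF if for some (equivalently, every) finite generating set $S$ there is a constant $C>0$ (depending on $S$) such that $\mathcal{M}_\Gamma^S(n)\leq C\log(n)$ for all $n\geq 2$. *)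

theory Defs
  imports "HOL-Algebra.Elementary_Groups" "HOL-Algebra.Generated_Groups" "HOL-Library.Extended_Real"
begin

section \<open>Free groups\<close>

text \<open>
  A letter \<open>(x, True)\<close> stands for the generator \<open>x\<close> and \<open>(x, False)\<close> for its inverse. The free group
  on \<open>B\<close> consists of the freely reduced words; the product \<open>u v\<close> is obtained by putting the letters
  of \<open>u\<close> one after the other (last letter first) in front of \<open>v\<close>, cancelling whenever possible.
\<close>

fun fg_push :: "'x \<times> bool \<Rightarrow> ('x \<times> bool) list \<Rightarrow> ('x \<times> bool) list" where
  "fg_push a [] = [a]"
| "fg_push a (b # w) = (if fst b = fst a \<and> snd b \<noteq> snd a then w else a # b # w)"

definition fg_reduced :: "('x \<times> bool) list \<Rightarrow> bool" where
  "fg_reduced w \<longleftrightarrow> successively (\<lambda>a b. \<not> (fst b = fst a \<and> snd b \<noteq> snd a)) w"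

definition free_group :: "'x set \<Rightarrow> ('x \<times> bool) list monoid" where
  "free_group B =
     \<lparr>carrier = {w. fst ` set w \<subseteq> B \<and> fg_reduced w}, monoid.mult = (\<lambda>u v. foldr fg_push u v), one = []\<rparr>"


section \<open>Free products\<close>

text \<open>
  Elements are the reduced words: lists of nontrivial elements of \<open>G\<close> (tagged \<open>Inl\<close>) and of \<open>H\<close>
  (tagged \<open>Inr\<close>) that come alternately from the two factors.
\<close>

fun fp_push ::
  "('a, 'm) monoid_scheme \<Rightarrow> ('b, 'n) monoid_scheme \<Rightarrow> 'a + 'b \<Rightarrow> ('a + 'b) list \<Rightarrow> ('a + 'b) list" where
  "fp_push G H (Inl a) (Inl b # w) =
     (if a \<otimes>\<^bsub>G\<^esub> b = \<one>\<^bsub>G\<^esub> then w else Inl (a \<otimes>\<^bsub>G\<^esub> b) # w)"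
| "fp_push G H (Inr a) (Inr b # w) =
     (if a \<otimes>\<^bsub>H\<^esub> b = \<one>\<^bsub>H\<^esub> then w else Inr (a \<otimes>\<^bsub>H\<^esub> b) # w)"
| "fp_push G H l w = l # w"

definition fp_letters :: "('a, 'm) monoid_scheme \<Rightarrow> ('b, 'n) monoid_scheme \<Rightarrow> ('a + 'b) set" where
  "fp_letters G H = Inl ` (carrier G - {\<one>\<^bsub>G\<^esub>}) \<union> Inr ` (carrier H - {\<one>\<^bsub>H\<^esub>})"

definition free_product ::
  "('a, 'm) monoid_scheme \<Rightarrow> ('b, 'n) monoid_scheme \<Rightarrow> ('a + 'b) list monoid" where
  "free_product G H =
     \<lparr>carrier = {w. set w \<subseteq> fp_letters G H \<and> successively (\<lambda>l m. isl l \<noteq> isl m) w},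
      monoid.mult = (\<lambda>u v. foldr (fp_push G H) u v), one = []\<rparr>"

definition fp_inl :: "('a, 'm) monoid_scheme \<Rightarrow> 'a \<Rightarrow> ('a + 'b) list" where
  "fp_inl G a = (if a = \<one>\<^bsub>G\<^esub> then [] else [Inl a])"

definition fp_inr :: "('b, 'n) monoid_scheme \<Rightarrow> 'b \<Rightarrow> ('a + 'b) list" where
  "fp_inr H b = (if b = \<one>\<^bsub>H\<^esub> then [] else [Inr b])"

definition fp_lift ::
  "('k, 'm) monoid_scheme \<Rightarrow> ('a \<Rightarrow> 'k) \<Rightarrow> ('b \<Rightarrow> 'k) \<Rightarrow> ('a + 'b) list \<Rightarrow> 'k" where
  "fp_lift K f g w = foldr (\<lambda>l k. case_sum f g l \<otimes>\<^bsub>K\<^esub> k) w \<one>\<^bsub>K\<^esub>"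


section \<open>Word length and MIF growth\<close>

text \<open>The value is \<open>\<infinity>\<close> for elements that are not in the subgroup generated by \<open>S\<close>.\<close>

definition word_length :: "('a, 'm) monoid_scheme \<Rightarrow> 'a set \<Rightarrow> 'a \<Rightarrow> enat" where
  "word_length G S g =
     (INF us \<in> {us. set us \<subseteq> S \<union> m_inv G ` S \<and> foldr (monoid.mult G) us \<one>\<^bsub>G\<^esub> = g}. enat (length us))"

abbreviation adjoin_var :: "('a, 'm) monoid_scheme \<Rightarrow> ('a + int) list monoid" where
  "adjoin_var G \<equiv> free_product G integer_group"

definition free_var :: "('a + int) list" where
  "free_var = fp_inr integer_group 1"

definition gens_with_var :: "('a, 'm) monoid_scheme \<Rightarrow> 'a set \<Rightarrow> ('a + int) list set" where
  "gens_with_var G S = insert free_var (fp_inl G ` S)"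

definition eval_word :: "('a, 'm) monoid_scheme \<Rightarrow> ('a + int) list \<Rightarrow> 'a \<Rightarrow> 'a" where
  "eval_word G w g = fp_lift G (\<lambda>a. a) (\<lambda>n::int. g [^]\<^bsub>G\<^esub> n) w"

text \<open>
  The minimum and the maximum are rendered as infimum and supremum in \<^typ>\<open>enat\<close>. The infimum is
  attained if its index set is nonempty, and it is \<open>\<infinity>\<close> otherwise. For finite \<open>S\<close> and \<open>n \<ge> 1\<close> the index
  set of the supremum is finite and nonempty.
\<close>

definition mif_complexity :: "('a, 'm) monoid_scheme \<Rightarrow> 'a set \<Rightarrow> ('a + int) list \<Rightarrow> enat" where
  "mif_complexity G S w =
     (INF g \<in> {g \<in> carrier G. eval_word G w g \<noteq> \<one>\<^bsub>G\<^esub>}. word_length G S g)"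

definition mif_growth :: "('a, 'm) monoid_scheme \<Rightarrow> 'a set \<Rightarrow> nat \<Rightarrow> enat" where
  "mif_growth G S n =
     (SUP w \<in> {w \<in> carrier (adjoin_var G). w \<noteq> \<one>\<^bsub>adjoin_var G\<^esub> \<and>
                word_length (adjoin_var G) (gens_with_var G S) w \<le> enat n}. mif_complexity G S w)"

definition finite_gen_set :: "('a, 'm) monoid_scheme \<Rightarrow> 'a set \<Rightarrow> bool" where
  "finite_gen_set G S \<longleftrightarrow> finite S \<and> S \<subseteq> carrier G \<and> generate G S = carrier G"

definition sharply_MIF_wrt :: "('a, 'm) monoid_scheme \<Rightarrow> 'a set \<Rightarrow> bool" where
  "sharply_MIF_wrt G S \<longleftrightarrow>
     (\<exists>C>0. \<forall>n\<ge>2. ereal_of_enat (mif_growth G S n) \<le> ereal (C * ln (real n)))"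

text \<open>The choice of the generating set is immaterial, see \<open>sharply_MIF_iff\<close> below.\<close>

definition sharply_MIF :: "('a, 'm) monoid_scheme \<Rightarrow> bool" where
  "sharply_MIF G \<longleftrightarrow> (\<exists>S. finite_gen_set G S \<and> sharply_MIF_wrt G S)"


section \<open>Group laws and induced homomorphisms\<close>

lemma fg_push_cancel:
  assumes "fg_reduced w"
  shows "fg_push (x, \<not> b) (fg_push (x, b) w) = w"
proof (cases w)
  case (Cons c v)
  show ?thesis
  proof (cases "c = (x, \<not> b)")
    case True
    then show ?thesis using Cons assms
      by (cases v) (auto simp: fg_reduced_def)
  next
    case False
    then show ?thesis using Cons by (cases c) auto
  qed
qed auto

lemma fg_push_reduced: "fg_reduced w \<Longrightarrow> fg_reduced (fg_push a w)"
  by (cases w) (auto simp: fg_reduced_def successively_Cons)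

lemma fg_mult_reduced: "fg_reduced v \<Longrightarrow> fg_reduced (foldr fg_push u v)"
  by (induction u) (auto intro: fg_push_reduced)

lemma fg_push_fst: "fst ` set (fg_push a w) \<subseteq> insert (fst a) (fst ` set w)"
  by (cases w) auto

lemma fg_mult_fst: "fst ` set (foldr fg_push u v) \<subseteq> fst ` set u \<union> fst ` set v"
proof (induction u)
  case (Cons a u)
  then show ?case using fg_push_fst[of a "foldr fg_push u v"] by simp blast
qed simp

lemma fg_mult_push:
  assumes "fg_reduced z"
  shows "foldr fg_push (fg_push a w) z = fg_push a (foldr fg_push w z)"
proof (cases w)
  case (Cons c v)
  show ?thesis
  proof (cases "fst c = fst a \<and> snd c \<noteq> snd a")
    case True
    then have a: "a = (fst c, \<not> snd c)" by (cases a) auto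
    show ?thesis using fg_push_cancel[OF fg_mult_reduced[OF assms], of "fst c" "snd c" v]
      by (simp add: Cons a)
  qed (use Cons in auto)
qed auto

lemma fg_mult_assoc:
  "fg_reduced z \<Longrightarrow> foldr fg_push (foldr fg_push u v) z = foldr fg_push u (foldr fg_push v z)"
  by (induction u) (auto simp: fg_mult_push)

lemma fg_push_Cons: "fg_reduced (a # w) \<Longrightarrow> fg_push a w = a # w"
  by (cases w) (auto simp: fg_reduced_def)

lemma fg_mult_Nil: "fg_reduced w \<Longrightarrow> foldr fg_push w [] = w"
proof (induction w)
  case (Cons a w)
  then have "fg_reduced w" by (auto simp: fg_reduced_def successively_Cons)
  then show ?case using Cons fg_push_Cons[of a w] by auto
qed auto

lemma fg_mult_inv:
  "fg_reduced w \<Longrightarrow> foldr fg_push (rev (map (\<lambda>(x, b). (x, \<not> b)) w)) w = []"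
proof (induction w)
  case (Cons a w)
  obtain x b where a: "a = (x, b)" by (cases a)
  have red: "fg_reduced w" using Cons.prems by (auto simp: fg_reduced_def successively_Cons)
  show ?case using Cons.IH[OF red] by (simp add: a)
qed auto

lemma group_free_group: "group (free_group B)"
proof (rule groupI)
  fix x y z assume x: "x \<in> carrier (free_group B)" and y: "y \<in> carrier (free_group B)"
    and z: "z \<in> carrier (free_group B)"
  show "x \<otimes>\<^bsub>free_group B\<^esub> y \<in> carrier (free_group B)"
    using x y order.trans[OF fg_mult_fst[of x y], of B] fg_mult_reduced[of y x]
    by (simp add: free_group_def)
  show "x \<otimes>\<^bsub>free_group B\<^esub> y \<otimes>\<^bsub>free_group B\<^esub> z = x \<otimes>\<^bsub>free_group B\<^esub> (y \<otimes>\<^bsub>free_group B\<^esub> z)"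
    using z by (auto simp: free_group_def fg_mult_assoc)
next
  fix x assume x: "x \<in> carrier (free_group B)"
  let ?y = "rev (map (\<lambda>(x, b). (x, \<not> b)) x)"
  have "fg_reduced ?y" using x
    by (auto simp: free_group_def fg_reduced_def successively_map case_prod_unfold
        elim!: successively_mono)
  moreover have "fst ` set ?y \<subseteq> B" using x by (force simp: free_group_def)
  ultimately have "?y \<in> carrier (free_group B)" by (simp add: free_group_def)
  moreover have "?y \<otimes>\<^bsub>free_group B\<^esub> x = \<one>\<^bsub>free_group B\<^esub>"
    using x by (simp add: free_group_def fg_mult_inv)
  ultimately show "\<exists>y\<in>carrier (free_group B). y \<otimes>\<^bsub>free_group B\<^esub> x = \<one>\<^bsub>free_group B\<^esub>" by blast
qed (auto simp: free_group_def fg_reduced_def)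

definition fg_lift :: "('k, 'm) monoid_scheme \<Rightarrow> ('x \<Rightarrow> 'k) \<Rightarrow> ('x \<times> bool) list \<Rightarrow> 'k" where
  "fg_lift K f w = foldr (\<lambda>a k. (if snd a then f (fst a) else inv\<^bsub>K\<^esub> f (fst a)) \<otimes>\<^bsub>K\<^esub> k) w \<one>\<^bsub>K\<^esub>"

lemma fg_lift_closed:
  assumes "group K" "f ` B \<subseteq> carrier K" "fst ` set w \<subseteq> B"
  shows "fg_lift K f w \<in> carrier K"
proof -
  interpret group K by fact
  show ?thesis using assms(3)
  proof (induction w)
    case (Cons a w)
    then have "f (fst a) \<in> carrier K" using assms(2) by auto
    then show ?case using Cons by (auto simp: fg_lift_def)
  qed (auto simp: fg_lift_def)
qed

lemma fg_lift_push:
  assumes "group K" "f ` B \<subseteq> carrier K" "fst ` set w \<subseteq> B" "fst a \<in> B"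
  shows "fg_lift K f (fg_push a w) =
    (if snd a then f (fst a) else inv\<^bsub>K\<^esub> f (fst a)) \<otimes>\<^bsub>K\<^esub> fg_lift K f w"
proof -
  interpret group K by fact
  show ?thesis
  proof (cases w)
    case Nil
    then show ?thesis by (simp add: fg_lift_def)
  next
    case (Cons b v)
    have "f (fst a) \<in> carrier K" "fg_lift K f v \<in> carrier K"
      using assms Cons fg_lift_closed[OF assms(1,2), of v] by auto
    then show ?thesis using Cons by (auto simp: fg_lift_def m_assoc[symmetric])
  qed
qed

lemma fg_lift_hom:
  assumes "group K" "f ` B \<subseteq> carrier K"
  shows "fg_lift K f \<in> hom (free_group B) K"
proof (rule homI)
  interpret group K by fact
  fix u assume u: "u \<in> carrier (free_group B)"
  show "fg_lift K f u \<in> carrier K" using fg_lift_closed[OF assms, of u] u by (auto simp: free_group_def)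
  fix v assume v: "v \<in> carrier (free_group B)"
  have v': "fst ` set v \<subseteq> B" using v by (auto simp: free_group_def)
  have "fst ` set u \<subseteq> B" using u by (auto simp: free_group_def)
  then have "fg_lift K f (foldr fg_push u v) = fg_lift K f u \<otimes>\<^bsub>K\<^esub> fg_lift K f v"
  proof (induction u)
    case Nil
    then show ?case using fg_lift_closed[OF assms v'] by (simp add: fg_lift_def)
  next
    case (Cons a u)
    have cl: "f (fst a) \<in> carrier K" "fg_lift K f u \<in> carrier K" "fg_lift K f v \<in> carrier K"
      using assms Cons.prems fg_lift_closed[OF assms, of u] fg_lift_closed[OF assms v'] by auto
    have "fg_lift K f (foldr fg_push (a # u) v) =
        (if snd a then f (fst a) else inv\<^bsub>K\<^esub> f (fst a)) \<otimes>\<^bsub>K\<^esub> fg_lift K f (foldr fg_push u v)"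
      using fg_lift_push[OF assms order.trans[OF fg_mult_fst[of u v]], of a] v' Cons.prems by simp
    also have "\<dots> = (if snd a then f (fst a) else inv\<^bsub>K\<^esub> f (fst a)) \<otimes>\<^bsub>K\<^esub> fg_lift K f u \<otimes>\<^bsub>K\<^esub> fg_lift K f v"
      using Cons cl by (auto simp: m_assoc)
    finally show ?case by (simp add: fg_lift_def)
  qed
  then show "fg_lift K f (u \<otimes>\<^bsub>free_group B\<^esub> v) = fg_lift K f u \<otimes>\<^bsub>K\<^esub> fg_lift K f v"
    by (simp add: free_group_def)
qed

lemma fp_mult [simp]: "x \<otimes>\<^bsub>free_product G H\<^esub> y = foldr (fp_push G H) x y"
  by (simp add: free_product_def)

lemma fp_one [simp]: "\<one>\<^bsub>free_product G H\<^esub> = []"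
  by (simp add: free_product_def)

lemma fp_Cons_iff:
  "l # w \<in> carrier (free_product G H) \<longleftrightarrow>
     l \<in> fp_letters G H \<and> w \<in> carrier (free_product G H) \<and> (w = [] \<or> isl l \<noteq> isl (hd w))"
  by (auto simp: free_product_def successively_Cons)

lemma fp_Nil [simp]: "[] \<in> carrier (free_product G H)"
  by (simp add: free_product_def)

lemma fp_push_Cons: "l # w \<in> carrier (free_product G H) \<Longrightarrow> fp_push G H l w = l # w"
  by (cases l; cases w rule: list.exhaust; cases "hd w") (auto simp: fp_Cons_iff)

locale two_groups = G: group G + H: group H
  for G :: "('a, 'm) monoid_scheme" and H :: "('b, 'n) monoid_scheme"
begin

definition act :: "'a + 'b \<Rightarrow> ('a + 'b) list \<Rightarrow> ('a + 'b) list" where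
  "act l w = (if l = Inl \<one>\<^bsub>G\<^esub> \<or> l = Inr \<one>\<^bsub>H\<^esub> then w else fp_push G H l w)"

lemma act_letter: "l \<in> fp_letters G H \<Longrightarrow> act l = fp_push G H l"
  by (auto simp: act_def fp_letters_def)

lemma act_closed:
  assumes "l \<in> Inl ` carrier G \<union> Inr ` carrier H" "w \<in> carrier (free_product G H)"
  shows "act l w \<in> carrier (free_product G H)"
proof (cases w)
  case Nil
  then show ?thesis using assms by (auto simp: act_def fp_Cons_iff fp_letters_def)
next
  case (Cons m v)
  then show ?thesis using assms
    by (cases l; cases m) (auto simp: act_def fp_Cons_iff fp_letters_def)
qed

lemma push_closed:
  assumes "l \<in> fp_letters G H" "w \<in> carrier (free_product G H)"
  shows "fp_push G H l w \<in> carrier (free_product G H)"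
  using act_closed[of l w] assms by (auto simp: act_letter) (auto simp: fp_letters_def)

lemma mult_closed:
  assumes "set u \<subseteq> fp_letters G H" "w \<in> carrier (free_product G H)"
  shows "foldr (fp_push G H) u w \<in> carrier (free_product G H)"
  using assms by (induction u) (auto intro: push_closed)

lemma act_Inl:
  assumes "a \<in> carrier G" "b \<in> carrier G" "w \<in> carrier (free_product G H)"
  shows "act (Inl a) (act (Inl b) w) = act (Inl (a \<otimes>\<^bsub>G\<^esub> b)) w"
proof -
  consider c v where "w = Inl c # v" "c \<in> carrier G" "c \<noteq> \<one>\<^bsub>G\<^esub>" "v = [] \<or> \<not> isl (hd v)"
    | "w = [] \<or> (\<exists>c v. w = Inr c # v)"
    using assms(3) by (cases w; cases "hd w") (auto simp: fp_Cons_iff fp_letters_def)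
  then show ?thesis
  proof cases
    case 1
    have *: "act (Inl d) v = (if d = \<one>\<^bsub>G\<^esub> then v else Inl d # v)" for d
      using 1 by (cases v; cases "hd v") (auto simp: act_def)
    have **: "act (Inl d) w = act (Inl (d \<otimes>\<^bsub>G\<^esub> c)) v" if "d \<in> carrier G" for d
      using that 1 by (auto simp: *) (auto simp: act_def)
    have "act (Inl a) (act (Inl d) v) = act (Inl (a \<otimes>\<^bsub>G\<^esub> d)) v" if "d \<in> carrier G" for d
      using that assms by (auto simp: *) (auto simp: act_def)
    then show ?thesis using assms 1(2) by (simp add: ** G.m_assoc)
  next
    case 2
    have *: "act (Inl d) w = (if d = \<one>\<^bsub>G\<^esub> then w else Inl d # w)" for d
      using 2 by (auto simp: act_def)
    show ?thesis using assms by (auto simp: *) (auto simp: act_def)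
  qed
qed

lemma act_Inr:
  assumes "a \<in> carrier H" "b \<in> carrier H" "w \<in> carrier (free_product G H)"
  shows "act (Inr a) (act (Inr b) w) = act (Inr (a \<otimes>\<^bsub>H\<^esub> b)) w"
proof -
  consider c v where "w = Inr c # v" "c \<in> carrier H" "c \<noteq> \<one>\<^bsub>H\<^esub>" "v = [] \<or> isl (hd v)"
    | "w = [] \<or> (\<exists>c v. w = Inl c # v)"
    using assms(3) by (cases w; cases "hd w") (auto simp: fp_Cons_iff fp_letters_def)
  then show ?thesis
  proof cases
    case 1
    have *: "act (Inr d) v = (if d = \<one>\<^bsub>H\<^esub> then v else Inr d # v)" for d
      using 1 by (cases v; cases "hd v") (auto simp: act_def)
    have **: "act (Inr d) w = act (Inr (d \<otimes>\<^bsub>H\<^esub> c)) v" if "d \<in> carrier H" for d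
      using that 1 by (auto simp: *) (auto simp: act_def)
    have "act (Inr a) (act (Inr d) v) = act (Inr (a \<otimes>\<^bsub>H\<^esub> d)) v" if "d \<in> carrier H" for d
      using that assms by (auto simp: *) (auto simp: act_def)
    then show ?thesis using assms 1(2) by (simp add: ** H.m_assoc)
  next
    case 2
    have *: "act (Inr d) w = (if d = \<one>\<^bsub>H\<^esub> then w else Inr d # w)" for d
      using 2 by (auto simp: act_def)
    show ?thesis using assms by (auto simp: *) (auto simp: act_def)
  qed
qed

lemma mult_push:
  assumes l: "l \<in> fp_letters G H" and w: "set w \<subseteq> fp_letters G H"
    and z: "z \<in> carrier (free_product G H)"
  shows "foldr (fp_push G H) (fp_push G H l w) z = fp_push G H l (foldr (fp_push G H) w z)"
proof (cases w)
  case (Cons m v)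
  let ?z = "foldr (fp_push G H) v z"
  have zc: "?z \<in> carrier (free_product G H)" using mult_closed[OF _ z] w Cons by auto
  show ?thesis
  proof (cases l; cases m)
    fix a b assume ab: "l = Inl a" "m = Inl b"
    then have "a \<in> carrier G" "a \<noteq> \<one>\<^bsub>G\<^esub>" "b \<in> carrier G" "b \<noteq> \<one>\<^bsub>G\<^esub>"
      using l w Cons by (auto simp: fp_letters_def)
    then show ?thesis using act_Inl[of a b ?z] zc Cons ab by (auto simp: act_def split: if_splits)
  next
    fix a b assume ab: "l = Inr a" "m = Inr b"
    then have "a \<in> carrier H" "a \<noteq> \<one>\<^bsub>H\<^esub>" "b \<in> carrier H" "b \<noteq> \<one>\<^bsub>H\<^esub>"
      using l w Cons by (auto simp: fp_letters_def)
    then show ?thesis using act_Inr[of a b ?z] zc Cons ab by (auto simp: act_def split: if_splits)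
  qed (use Cons in auto)
qed (cases l; auto)

lemma mult_assoc:
  assumes "set u \<subseteq> fp_letters G H" "v \<in> carrier (free_product G H)" "z \<in> carrier (free_product G H)"
  shows "foldr (fp_push G H) (foldr (fp_push G H) u v) z = foldr (fp_push G H) u (foldr (fp_push G H) v z)"
  using assms(1)
proof (induction u)
  case (Cons l u)
  have "set (foldr (fp_push G H) u v) \<subseteq> fp_letters G H"
    using mult_closed[of u v] Cons.prems assms(2) by (auto simp: free_product_def)
  then show ?case using Cons assms by (simp add: mult_push)
qed auto

definition inv_letter :: "'a + 'b \<Rightarrow> 'a + 'b" where
  "inv_letter = map_sum (m_inv G) (m_inv H)"

lemma mult_inv:
  "w \<in> carrier (free_product G H) \<Longrightarrow> foldr (fp_push G H) (rev (map inv_letter w)) w = []"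
proof (induction w)
  case (Cons l w)
  then have "l \<in> fp_letters G H" "w \<in> carrier (free_product G H)" by (auto simp: fp_Cons_iff)
  moreover from this have "fp_push G H (inv_letter l) (l # w) = w"
    by (auto simp: fp_letters_def inv_letter_def)
  ultimately show ?case using Cons.IH by simp
qed auto

lemma group_free_product: "group (free_product G H)"
proof (rule groupI)
  fix x assume x: "x \<in> carrier (free_product G H)"
  let ?y = "rev (map inv_letter x)"
  have "inv_letter l \<in> fp_letters G H" if "l \<in> fp_letters G H" for l
    using that by (auto simp: fp_letters_def inv_letter_def)
  then have "set ?y \<subseteq> fp_letters G H"
    using x by (auto simp: free_product_def)
  moreover have "successively (\<lambda>l m. isl l \<noteq> isl m) ?y"
    using x by (auto simp: free_product_def inv_letter_def successively_map isl_map_sum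
        elim!: successively_mono)
  ultimately have "?y \<in> carrier (free_product G H)" by (simp add: free_product_def)
  moreover have "?y \<otimes>\<^bsub>free_product G H\<^esub> x = \<one>\<^bsub>free_product G H\<^esub>"
    using mult_inv[OF x] by simp
  ultimately show "\<exists>y\<in>carrier (free_product G H). y \<otimes>\<^bsub>free_product G H\<^esub> x = \<one>\<^bsub>free_product G H\<^esub>" by blast
next
  fix x y assume "x \<in> carrier (free_product G H)" "y \<in> carrier (free_product G H)"
  then show "x \<otimes>\<^bsub>free_product G H\<^esub> y \<in> carrier (free_product G H)"
    using mult_closed[of x y] by (auto simp: free_product_def)
next
  fix x y z assume "x \<in> carrier (free_product G H)" "y \<in> carrier (free_product G H)"
     "z \<in> carrier (free_product G H)"
  then show "x \<otimes>\<^bsub>free_product G H\<^esub> y \<otimes>\<^bsub>free_product G H\<^esub> z =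
      x \<otimes>\<^bsub>free_product G H\<^esub> (y \<otimes>\<^bsub>free_product G H\<^esub> z)"
    using mult_assoc[of x y z] by (auto simp: free_product_def)
qed auto

lemma fp_inl_hom: "fp_inl G \<in> hom G (free_product G H)"
  by (rule homI) (auto simp: fp_inl_def fp_Cons_iff fp_letters_def)

lemma fp_inr_hom: "fp_inr H \<in> hom H (free_product G H)"
  by (rule homI) (auto simp: fp_inr_def fp_Cons_iff fp_letters_def)

lemma fp_Cons_eq:
  assumes "l # w \<in> carrier (free_product G H)"
  shows "l # w = case_sum (fp_inl G) (fp_inr H) l \<otimes>\<^bsub>free_product G H\<^esub> w"
  using assms fp_push_Cons[OF assms]
  by (cases l) (auto simp: fp_inl_def fp_inr_def fp_Cons_iff fp_letters_def)

context
  fixes K :: "('k, 'p) monoid_scheme" and f g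
  assumes K: "group K" and f: "f \<in> hom G K" and g: "g \<in> hom H K"
begin

interpretation K: group K by (fact K)
interpretation f: group_hom G K f by unfold_locales (fact f)
interpretation g: group_hom H K g by unfold_locales (fact g)

lemma fp_lift_closed: "set w \<subseteq> fp_letters G H \<Longrightarrow> fp_lift K f g w \<in> carrier K"
  by (induction w) (auto simp: fp_lift_def fp_letters_def)

lemma fp_lift_push:
  assumes "l \<in> fp_letters G H" "set w \<subseteq> fp_letters G H"
  shows "fp_lift K f g (fp_push G H l w) = case_sum f g l \<otimes>\<^bsub>K\<^esub> fp_lift K f g w"
proof (cases w)
  case Nil
  then show ?thesis using assms by (cases l) (auto simp: fp_lift_def)
next
  case (Cons m v)
  have v: "fp_lift K f g v \<in> carrier K" using fp_lift_closed[of v] assms Cons by auto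
  show ?thesis
  proof (cases l; cases m)
    fix a b assume ab: "l = Inl a" "m = Inl b"
    then have "a \<in> carrier G" "b \<in> carrier G" using assms Cons by (auto simp: fp_letters_def)
    then show ?thesis using ab v Cons f.hom_mult[of a b]
      by (auto simp: fp_lift_def K.m_assoc[symmetric] simp flip: f.hom_mult)
  next
    fix a b assume ab: "l = Inr a" "m = Inr b"
    then have "a \<in> carrier H" "b \<in> carrier H" using assms Cons by (auto simp: fp_letters_def)
    then show ?thesis using ab v Cons g.hom_mult[of a b]
      by (auto simp: fp_lift_def K.m_assoc[symmetric] simp flip: g.hom_mult)
  qed (use Cons in \<open>auto simp: fp_lift_def\<close>)
qed

lemma fp_lift_hom: "fp_lift K f g \<in> hom (free_product G H) K"
proof (rule homI)
  fix u assume "u \<in> carrier (free_product G H)"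
  then have u: "set u \<subseteq> fp_letters G H" by (auto simp: free_product_def)
  then show "fp_lift K f g u \<in> carrier K" by (rule fp_lift_closed)
  fix v assume v: "v \<in> carrier (free_product G H)"
  then have vc: "fp_lift K f g v \<in> carrier K" by (intro fp_lift_closed) (auto simp: free_product_def)
  from u have "fp_lift K f g (foldr (fp_push G H) u v) = fp_lift K f g u \<otimes>\<^bsub>K\<^esub> fp_lift K f g v"
  proof (induction u)
    case Nil
    then show ?case using vc by (simp add: fp_lift_def)
  next
    case (Cons l u)
    have "set (foldr (fp_push G H) u v) \<subseteq> fp_letters G H"
      using mult_closed[of u v] Cons.prems v by (auto simp: free_product_def)
    moreover have "case_sum f g l \<in> carrier K" using Cons.prems by (auto simp: fp_letters_def)
    moreover have "fp_lift K f g u \<in> carrier K" using fp_lift_closed Cons.prems by auto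
    ultimately show ?case using Cons fp_lift_push[of l] vc
      by (simp add: K.m_assoc) (simp add: fp_lift_def K.m_assoc)
  qed
  then show "fp_lift K f g (u \<otimes>\<^bsub>free_product G H\<^esub> v) = fp_lift K f g u \<otimes>\<^bsub>K\<^esub> fp_lift K f g v" by simp
qed

lemma fp_lift_inl: "a \<in> carrier G \<Longrightarrow> fp_lift K f g (fp_inl G a) = f a"
  by (auto simp: fp_lift_def fp_inl_def)

lemma fp_lift_inr: "b \<in> carrier H \<Longrightarrow> fp_lift K f g (fp_inr H b) = g b"
  by (auto simp: fp_lift_def fp_inr_def)

lemma fp_lift_unique:
  assumes h: "h \<in> hom (free_product G H) K"
    and "\<And>a. a \<in> carrier G \<Longrightarrow> h (fp_inl G a) = f a"
    and "\<And>b. b \<in> carrier H \<Longrightarrow> h (fp_inr H b) = g b"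
    and "w \<in> carrier (free_product G H)"
  shows "h w = fp_lift K f g w"
proof -
  interpret h: group_hom "free_product G H" K h
    using group_free_product K h by (auto intro!: group_hom.intro simp: group_hom_axioms_def)
  show ?thesis using assms(4)
  proof (induction w)
    case Nil
    then show ?case using h.hom_one by (simp add: fp_lift_def)
  next
    case (Cons l w)
    have l: "l \<in> fp_letters G H" and w: "w \<in> carrier (free_product G H)"
      using Cons.prems by (auto simp: fp_Cons_iff)
    have c: "case_sum (fp_inl G) (fp_inr H) l \<in> carrier (free_product G H)"
      using l hom_in_carrier[OF fp_inl_hom] hom_in_carrier[OF fp_inr_hom] by (auto simp: fp_letters_def)
    have "h (l # w) = h (case_sum (fp_inl G) (fp_inr H) l) \<otimes>\<^bsub>K\<^esub> h w"
      by (subst fp_Cons_eq[OF Cons.prems], rule h.hom_mult[OF c w])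
    also have "h (case_sum (fp_inl G) (fp_inr H) l) = case_sum f g l"
      using assms(2,3) l by (auto simp: fp_letters_def)
    finally show ?case using Cons.IH[OF w] by (simp add: fp_lift_def)
  qed
qed

end

end


section \<open>The substitution homomorphism\<close>

context group
begin

interpretation Z: two_groups G integer_group
  by (intro two_groups.intro is_group group_integer_group)

lemma group_adjoin_var: "group (adjoin_var G)"
  by (rule Z.group_free_product)

lemma int_pow_hom_integer_group:
  "g \<in> carrier G \<Longrightarrow> (\<lambda>n::int. g [^] n) \<in> hom integer_group G"
  by (rule homI) (auto simp: integer_group_def int_pow_mult)

lemma id_hom: "(\<lambda>a. a) \<in> hom G G"
  by (rule homI) auto

lemma eval_word_hom: "g \<in> carrier G \<Longrightarrow> (\<lambda>w. eval_word G w g) \<in> hom (adjoin_var G) G"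
  unfolding eval_word_def
  by (rule Z.fp_lift_hom[OF is_group id_hom int_pow_hom_integer_group])

lemma eval_word_const: "a \<in> carrier G \<Longrightarrow> eval_word G (fp_inl G a) g = a"
  by (auto simp: eval_word_def fp_lift_def fp_inl_def)

lemma eval_word_var: "g \<in> carrier G \<Longrightarrow> eval_word G free_var g = g"
  by (auto simp: eval_word_def fp_lift_def fp_inr_def free_var_def integer_group_def int_pow_1)

lemma free_var_closed: "free_var \<in> carrier (adjoin_var G)"
  unfolding free_var_def by (rule hom_in_carrier[OF Z.fp_inr_hom]) (auto simp: integer_group_def)

lemma eval_word_unique:
  assumes "g \<in> carrier G" "h \<in> hom (adjoin_var G) G"
    and "\<And>a. a \<in> carrier G \<Longrightarrow> h (fp_inl G a) = a" "h free_var = g" "w \<in> carrier (adjoin_var G)"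
  shows "h w = eval_word G w g"
  unfolding eval_word_def
proof (rule Z.fp_lift_unique[OF is_group id_hom int_pow_hom_integer_group[OF assms(1)] assms(2)])
  interpret h: group_hom "adjoin_var G" G h
    using group_adjoin_var is_group assms(2) by (auto intro!: group_hom.intro simp: group_hom_axioms_def)
  interpret i: group_hom integer_group "adjoin_var G" "fp_inr integer_group"
    using group_adjoin_var Z.fp_inr_hom
    by (auto intro!: group_hom.intro simp: group_hom_axioms_def)
  fix n :: int
  have "fp_inr integer_group n = free_var [^]\<^bsub>adjoin_var G\<^esub> n"
    using i.hom_int_pow[of 1 n] by (simp add: free_var_def group_int_pow_integer_group)
  then show "h (fp_inr integer_group n) = g [^] n"
    using h.hom_int_pow[OF free_var_closed, of n] assms(4) by simp
qed (use assms in auto)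

end


section \<open>Independence of the generating set\<close>

context group
begin

definition lprod :: "'a list \<Rightarrow> 'a" where
  "lprod us = foldr (monoid.mult G) us \<one>"

lemma lprod_simps [simp]: "lprod [] = \<one>" "lprod (u # us) = u \<otimes> lprod us"
  by (simp_all add: lprod_def)

lemma lprod_closed [simp]: "set us \<subseteq> carrier G \<Longrightarrow> lprod us \<in> carrier G"
  by (induction us) auto

lemma lprod_append:
  "set us \<subseteq> carrier G \<Longrightarrow> set vs \<subseteq> carrier G \<Longrightarrow> lprod (us @ vs) = lprod us \<otimes> lprod vs"
  by (induction us) (auto simp: m_assoc)

lemma lprod_inv:
  "set us \<subseteq> carrier G \<Longrightarrow> lprod (rev (map (m_inv G) us)) = inv (lprod us)"
proof (induction us)
  case (Cons u us)
  have "lprod (rev (map (m_inv G) us) @ [inv u]) = lprod (rev (map (m_inv G) us)) \<otimes> inv u"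
    using Cons.prems by (subst lprod_append) auto
  then show ?case using Cons by (simp add: inv_mult_group)
qed auto

lemma word_length_le:
  "set us \<subseteq> S \<union> m_inv G ` S \<Longrightarrow> lprod us = g \<Longrightarrow> word_length G S g \<le> enat (length us)"
  unfolding word_length_def lprod_def by (rule INF_lower) auto

lemma word_length_attained:
  assumes "word_length G S g \<noteq> \<infinity>"
  obtains us where "set us \<subseteq> S \<union> m_inv G ` S" "lprod us = g" "word_length G S g = enat (length us)"
proof -
  let ?A = "(\<lambda>us. enat (length us)) ` {us. set us \<subseteq> S \<union> m_inv G ` S \<and> lprod us = g}"
  have eq: "word_length G S g = Inf ?A" by (simp add: word_length_def lprod_def)
  have "?A \<noteq> {}"
  proof
    assume "?A = {}"
    then have "Inf ?A = Inf {}" by (rule arg_cong)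
    then show False using assms unfolding eq by (simp add: Inf_enat_def)
  qed
  then have "Inf ?A \<in> ?A" by (rule wellorder_InfI[OF ex_in_conv[THEN iffD2, THEN someI_ex]])
  then show ?thesis using that eq by auto
qed

lemma letters_closed: "S \<subseteq> carrier G \<Longrightarrow> S \<union> m_inv G ` S \<subseteq> carrier G"
  by auto

lemma word_length_mult:
  assumes "S \<subseteq> carrier G"
  shows "word_length G S (g \<otimes> h) \<le> word_length G S g + word_length G S h"
proof (cases "word_length G S g = \<infinity> \<or> word_length G S h = \<infinity>")
  case False
  then obtain us vs where *: "set us \<subseteq> S \<union> m_inv G ` S" "lprod us = g" "word_length G S g = enat (length us)"
      "set vs \<subseteq> S \<union> m_inv G ` S" "lprod vs = h" "word_length G S h = enat (length vs)"
    using word_length_attained by metis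
  then have "lprod (us @ vs) = g \<otimes> h"
    using lprod_append[of us vs] letters_closed[OF assms] by blast
  then show ?thesis using word_length_le[of "us @ vs" S "g \<otimes> h"] * by simp
qed auto

lemma word_length_inv:
  assumes "S \<subseteq> carrier G"
  shows "word_length G S (inv g) \<le> word_length G S g"
proof (cases "word_length G S g = \<infinity>")
  case False
  then obtain us where *: "set us \<subseteq> S \<union> m_inv G ` S" "lprod us = g" "word_length G S g = enat (length us)"
    using word_length_attained by metis
  have "lprod (rev (map (m_inv G) us)) = inv g"
    using lprod_inv[of us] * letters_closed[OF assms] by blast
  moreover have "inv x \<in> S \<union> m_inv G ` S" if "x \<in> S \<union> m_inv G ` S" for x
    using that subsetD[OF assms] by auto
  then have "set (rev (map (m_inv G) us)) \<subseteq> S \<union> m_inv G ` S"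
    using *(1) by (simp add: image_subset_iff) blast
  ultimately show ?thesis using word_length_le[of "rev (map (m_inv G) us)" S "inv g"] *(3) by simp
qed auto

lemma word_length_one [simp]: "word_length G S \<one> = 0"
  using word_length_le[of "[]" S \<one>] by (simp add: zero_enat_def[symmetric])

lemma word_length_finite:
  assumes "S \<subseteq> carrier G" "g \<in> generate G S"
  shows "word_length G S g \<noteq> \<infinity>"
  using assms(2)
proof induction
  case one
  then show ?case by simp
next
  case (incl h)
  then have "word_length G S h \<le> enat 1"
    using word_length_le[of "[h]" S h] assms(1) subsetD[OF assms(1)] by simp
  then show ?case by (cases "word_length G S h") auto
next
  case (inv h)
  then have "word_length G S (inv h) \<le> enat 1"
    using word_length_le[of "[inv h]" S "inv h"] assms(1) subsetD[OF assms(1)] by simp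
  then show ?case by (cases "word_length G S (inv h)") auto
next
  case (eng h1 h2)
  then show ?case using word_length_mult[OF assms(1), of h1 h2]
    by (cases "word_length G S (h1 \<otimes> h2)") auto
qed

lemma word_length_lipschitz:
  assumes S: "finite_gen_set G S" and T: "finite T" "T \<subseteq> carrier G"
  obtains K :: nat where "K \<ge> 1" "\<And>g. word_length G S g \<le> enat K * word_length G T g"
proof -
  have Sc: "S \<subseteq> carrier G" using S by (simp add: finite_gen_set_def)
  have fin: "word_length G S t \<noteq> \<infinity>" if "t \<in> T" for t
    using word_length_finite[OF Sc, of t] S T that by (auto simp: finite_gen_set_def)
  define K where "K = Suc (\<Sum>t\<in>T. the_enat (word_length G S t))"
  have K: "word_length G S t \<le> enat K" if "t \<in> T" for t
  proof -
    have "the_enat (word_length G S t) \<le> K"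
      unfolding K_def using member_le_sum[OF that, of "\<lambda>t. the_enat (word_length G S t)"] T(1) by simp
    then show ?thesis using fin[OF that] by (cases "word_length G S t") auto
  qed
  have K': "word_length G S t \<le> enat K" if t: "t \<in> T \<union> m_inv G ` T" for t
    using t K word_length_inv[OF Sc] order.trans by blast
  have *: "word_length G S (lprod us) \<le> enat K * enat (length us)" if "set us \<subseteq> T \<union> m_inv G ` T" for us
    using that
  proof (induction us)
    case Nil
    then show ?case by simp
  next
    case (Cons u us)
    have "word_length G S (u \<otimes> lprod us) \<le> word_length G S u + word_length G S (lprod us)"
      by (rule word_length_mult[OF Sc])
    also have "\<dots> \<le> enat K + enat K * enat (length us)"
      using Cons K' by (intro add_mono) auto
    finally show ?case by simp
  qed
  have "word_length G S g \<le> enat K * word_length G T g" for g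
  proof (cases "word_length G T g = \<infinity>")
    case True
    then show ?thesis by (simp add: K_def)
  next
    case False
    then show ?thesis using word_length_attained[OF False] * by metis
  qed
  then show ?thesis using that[of K] by (simp add: K_def)
qed

interpretation Z: two_groups G integer_group
  by (intro two_groups.intro is_group group_integer_group)

interpretation A: group "adjoin_var G"
  by (rule group_adjoin_var)

lemma finite_gen_set_with_var:
  assumes S: "finite_gen_set G S"
  shows "finite_gen_set (adjoin_var G) (gens_with_var G S)"
proof -
  let ?A = "adjoin_var G" and ?T = "gens_with_var G S"
  have Sc: "S \<subseteq> carrier G" and Sg: "generate G S = carrier G" using S by (auto simp: finite_gen_set_def)
  have Tc: "?T \<subseteq> carrier ?A"
    using Sc hom_in_carrier[OF Z.fp_inl_hom] free_var_closed by (auto simp: gens_with_var_def)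
  have sub: "subgroup (generate ?A ?T) ?A" by (rule A.generate_is_subgroup[OF Tc])
  interpret l: group_hom G ?A "fp_inl G"
    using is_group group_adjoin_var Z.fp_inl_hom by (auto intro!: group_hom.intro simp: group_hom_axioms_def)
  interpret i: group_hom integer_group ?A "fp_inr integer_group"
    using group_adjoin_var Z.fp_inr_hom
    by (auto intro!: group_hom.intro simp: group_hom_axioms_def)
  have L: "fp_inl G a \<in> generate ?A ?T" if "a \<in> carrier G" for a
  proof -
    have "fp_inl G ` generate G S = generate ?A (fp_inl G ` S)" by (rule l.generate_img[OF Sc, symmetric])
    also have "\<dots> \<subseteq> generate ?A ?T" by (rule A.mono_generate) (auto simp: gens_with_var_def)
    finally show ?thesis using that Sg by auto
  qed
  have R: "fp_inr integer_group n \<in> generate ?A ?T" for n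
  proof -
    have "fp_inr integer_group n = free_var [^]\<^bsub>?A\<^esub> n"
      using i.hom_int_pow[of 1 n] by (simp add: free_var_def)
    moreover have "free_var \<in> generate ?A ?T" by (auto simp: gens_with_var_def intro: generate.incl)
    ultimately show ?thesis using A.subgroup_int_pow_closed[OF sub] by simp
  qed
  have "w \<in> generate ?A ?T" if "w \<in> carrier ?A" for w
    using that
  proof (induction w)
    case Nil
    then show ?case using generate.one[of ?A ?T] by simp
  next
    case (Cons l w)
    have l: "l \<in> fp_letters G integer_group" and w: "w \<in> carrier ?A" using Cons.prems by (auto simp: fp_Cons_iff)
    have "case_sum (fp_inl G) (fp_inr integer_group) l \<in> generate ?A ?T"
      using l L R by (auto simp: fp_letters_def)
    then show ?case
      using Z.fp_Cons_eq[OF Cons.prems] generate.eng[OF _ Cons.IH[OF w]] by simp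
  qed
  then have "generate ?A ?T = carrier ?A" using A.generate_incl[OF Tc] by blast
  then show ?thesis using Tc S by (auto simp: finite_gen_set_def gens_with_var_def)
qed

lemma sharply_MIF_wrt_change:
  assumes S: "finite_gen_set G S" and T: "finite_gen_set G T" and "sharply_MIF_wrt G S"
  shows "sharply_MIF_wrt G T"
proof -
  let ?A = "adjoin_var G" and ?S = "gens_with_var G S" and ?T = "gens_with_var G T"
  obtain C where C: "C > 0" "\<And>n. n \<ge> 2 \<Longrightarrow> ereal_of_enat (mif_growth G S n) \<le> ereal (C * ln (real n))"
    using assms(3) by (auto simp: sharply_MIF_wrt_def)
  obtain K where K: "K \<ge> 1" "\<And>g. word_length G T g \<le> enat K * word_length G S g"
    using word_length_lipschitz[OF T, of S] S by (auto simp: finite_gen_set_def)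
  obtain L where L: "L \<ge> 1" "\<And>w. word_length ?A ?S w \<le> enat L * word_length ?A ?T w"
    using A.word_length_lipschitz[OF finite_gen_set_with_var[OF S], of ?T] finite_gen_set_with_var[OF T]
    by (auto simp: finite_gen_set_def)
  have chi: "mif_complexity G T w \<le> enat K * mif_complexity G S w" for w
  proof -
    let ?I = "{g \<in> carrier G. eval_word G w g \<noteq> \<one>}"
    show ?thesis
    proof (cases "?I = {}")
      case True
      then have "mif_complexity G S w = \<infinity>" unfolding mif_complexity_def by (simp add: Inf_enat_def)
      then show ?thesis using K(1) by simp
    next
      case False
      then have "Inf (word_length G S ` ?I) \<in> word_length G S ` ?I"
        by (intro wellorder_InfI[OF ex_in_conv[THEN iffD2, THEN someI_ex]]) auto
      then obtain g where g: "g \<in> ?I" "mif_complexity G S w = word_length G S g"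
        by (auto simp: mif_complexity_def)
      have "mif_complexity G T w \<le> word_length G T g"
        unfolding mif_complexity_def by (rule INF_lower[OF g(1)])
      then show ?thesis using K(2)[of g] g(2) by (metis order.trans)
    qed
  qed
  have growth: "mif_growth G T n \<le> enat K * mif_growth G S (L * n)" for n
    unfolding mif_growth_def[of G T]
  proof (rule SUP_least)
    fix w assume w: "w \<in> {w \<in> carrier ?A. w \<noteq> \<one>\<^bsub>?A\<^esub> \<and> word_length ?A ?T w \<le> enat n}"
    have "word_length ?A ?S w \<le> enat L * word_length ?A ?T w" by (rule L(2))
    also have "\<dots> \<le> enat L * enat n" using w by (intro mult_left_mono) auto
    finally have "mif_complexity G S w \<le> mif_growth G S (L * n)"
      unfolding mif_growth_def using w by (intro SUP_upper) auto
    then have "enat K * mif_complexity G S w \<le> enat K * mif_growth G S (L * n)"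
      by (intro mult_left_mono) auto
    then show "mif_complexity G T w \<le> enat K * mif_growth G S (L * n)"
      using chi[of w] by (rule order.trans[rotated])
  qed
  define D where "D = real K * C * (ln (real L) / ln 2 + 1)"
  have "D > 0" unfolding D_def using K(1) L(1) C(1) by (intro mult_pos_pos add_nonneg_pos) auto
  moreover have "ereal_of_enat (mif_growth G T n) \<le> ereal (D * ln (real n))" if n: "n \<ge> 2" for n
  proof -
    have "L * n \<ge> 2" using L(1) n mult_le_mono[of 1 L 2 n] by simp
    then have b: "ereal_of_enat (mif_growth G S (L * n)) \<le> ereal (C * ln (real (L * n)))" by (rule C(2))
    then obtain m where m: "mif_growth G S (L * n) = enat m" "real m \<le> C * ln (real (L * n))"
      by (cases "mif_growth G S (L * n)") auto
    obtain k where k: "mif_growth G T n = enat k" "k \<le> K * m"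
      using growth[of n] m(1) by (cases "mif_growth G T n") auto
    have "ln (real L) \<le> ln (real L) / ln 2 * ln (real n)"
    proof -
      have "ln (real L) * ln 2 \<le> ln (real L) * ln (real n)"
        using L(1) n by (intro mult_left_mono) auto
      then show ?thesis by (simp add: field_simps)
    qed
    then have "ln (real (L * n)) \<le> (ln (real L) / ln 2 + 1) * ln (real n)"
      using L(1) n by (simp add: ln_mult distrib_right)
    then have "C * ln (real (L * n)) \<le> C * ((ln (real L) / ln 2 + 1) * ln (real n))"
      using C(1) by (intro mult_left_mono) auto
    then have "real K * real m \<le> real K * (C * ((ln (real L) / ln 2 + 1) * ln (real n)))"
      using m(2) by (intro mult_left_mono) auto
    moreover have "real k \<le> real K * real m" using k(2) by (metis of_nat_le_iff of_nat_mult)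
    ultimately show ?thesis using k(1) by (simp add: D_def mult.assoc)
  qed
  ultimately show ?thesis unfolding sharply_MIF_wrt_def by blast
qed

theorem sharply_MIF_iff:
  "sharply_MIF G \<longleftrightarrow>
     (\<exists>S. finite_gen_set G S) \<and> (\<forall>S. finite_gen_set G S \<longrightarrow> sharply_MIF_wrt G S)"
  unfolding sharply_MIF_def using sharply_MIF_wrt_change by blast

end

end

theory Submission
  imports Defs
begin

text \<open>
  Let \<open>a \<noteq> b\<close> be free generators and \<open>v\<close> a positive word in \<open>a, b\<close> of length \<open>m + 1\<close> ending in \<open>a\<close>.
  Substituting \<open>v b v\<inverse>\<close> for the variable in \<open>w\<close> and conjugating by \<open>v\<close> gives the alternating product
  of the elements \<open>v\<inverse> c v\<close>, for the constants \<open>c\<close> of the normal form of \<open>w\<close>, and of powers of \<open>b\<close>.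
  If every \<open>v\<inverse> c v\<close> reduces to a word that begins with \<open>a\<inverse>\<close> and ends with \<open>a\<close>, then nothing
  cancels in this product, which is therefore nontrivial. For each \<open>c\<close> at most \<open>m + 2\<close> words \<open>v\<close> fail
  to have this property, one for each amount of cancellation in \<open>c v\<close>, and \<open>w\<close> has at most \<open>n\<close>
  constants. So a suitable \<open>v\<close> exists as soon as \<open>n (m + 2) < 2\<^sup>m\<close>, that is, with \<open>m\<close> of order \<open>log n\<close>.
\<close>

section \<open>Formal inverses, reducedness and cancellation of words\<close>

definition fg_inv :: "('x \<times> bool) list \<Rightarrow> ('x \<times> bool) list" where
  "fg_inv w = rev (map (\<lambda>(x, b). (x, \<not> b)) w)"

lemma fg_inv_Nil [simp]: "fg_inv [] = []"
  by (simp add: fg_inv_def)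

lemma fg_inv_Cons: "fg_inv (a # w) = fg_inv w @ [(fst a, \<not> snd a)]"
  by (simp add: fg_inv_def case_prod_unfold)

lemma fg_inv_append: "fg_inv (u @ v) = fg_inv v @ fg_inv u"
  by (simp add: fg_inv_def)

lemma fg_inv_inv [simp]: "fg_inv (fg_inv w) = w"
  by (induction w) (auto simp: fg_inv_Cons fg_inv_append)

lemma length_fg_inv [simp]: "length (fg_inv w) = length w"
  by (simp add: fg_inv_def)

lemma fg_inv_eq_Nil_iff [simp]: "fg_inv w = [] \<longleftrightarrow> w = []"
  by (simp add: fg_inv_def)

lemma fst_set_fg_inv [simp]: "fst ` set (fg_inv w) = fst ` set w"
  by (force simp: fg_inv_def)

lemma fst_hd_fg_inv: "w \<noteq> [] \<Longrightarrow> fst (hd (fg_inv w)) = fst (last w)"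
  by (simp add: fg_inv_def hd_rev last_map case_prod_unfold)

lemma fg_reduced_inv: "fg_reduced w \<Longrightarrow> fg_reduced (fg_inv w)"
  by (auto simp: fg_inv_def fg_reduced_def successively_map case_prod_unfold elim!: successively_mono)

lemma fg_reduced_Cons: "fg_reduced (a # w) \<Longrightarrow> fg_reduced w"
  by (auto simp: fg_reduced_def successively_Cons)

lemma fg_reduced_appendD: "fg_reduced (u @ v) \<Longrightarrow> fg_reduced u \<and> fg_reduced v"
  by (auto simp: fg_reduced_def successively_append_iff)

lemma fg_mult_append: "fg_reduced (u @ v) \<Longrightarrow> foldr fg_push u v = u @ v"
proof (induction u)
  case (Cons a u)
  then show ?case using fg_push_Cons[of a "u @ v"] fg_reduced_Cons[of a "u @ v"] by simp
qed simp

lemma fg_reduced_append: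
  assumes "fg_reduced u" "fg_reduced v" "u = [] \<or> v = [] \<or> fst (last u) \<noteq> fst (hd v)"
  shows "fg_reduced (u @ v)"
  using assms by (auto simp: fg_reduced_def successively_append_iff)

text \<open>The last letter of \<open>q\<close> and its inverse would be adjacent in the middle of
  the word.\<close>

lemma fg_reduced_no_cancel: "fg_reduced (q @ fg_inv q) \<Longrightarrow> q = []"
proof (induction q rule: rev_induct)
  case (snoc a q)
  have "fg_reduced ([a, (fst a, \<not> snd a)])"
    using snoc.prems fg_reduced_appendD[of q "[a, (fst a, \<not> snd a)] @ fg_inv q"]
      fg_reduced_appendD[of "[a, (fst a, \<not> snd a)]" "fg_inv q"]
    by (simp add: fg_inv_append fg_inv_Cons)
  then show ?case by (simp add: fg_reduced_def)
qed simp

text \<open>Adjacent letters cancel only if their signs differ. This covers both the positive words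
  used for conjugation and the powers of a generator.\<close>

lemma fg_reduced_constant_sign:
  assumes "snd ` set w \<subseteq> {s}"
  shows "fg_reduced w"
  using assms
proof (induction w)
  case (Cons a w)
  then show ?case by (cases w) (auto simp: fg_reduced_def)
qed (simp add: fg_reduced_def)

text \<open>The cancelled part \<open>r\<close> is a suffix of \<open>u\<close>, met by its inverse
  at the front of \<open>v\<close>. Every later cancellation argument starts from this
  splitting.\<close>

lemma fg_mult_cancellation:
  assumes "fg_reduced u"
  obtains p q r where "u = p @ r" "v = fg_inv r @ q" "foldr fg_push u v = p @ q"
proof -
  have "\<exists>p q r. u = p @ r \<and> v = fg_inv r @ q \<and> foldr fg_push u v = p @ q"
    using assms
  proof (induction u)
    case Nil
    then show ?case by simp
  next
    case (Cons a u)
    obtain p q r where *: "u = p @ r" "v = fg_inv r @ q" "foldr fg_push u v = p @ q"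
      using Cons.IH Cons.prems fg_reduced_Cons by blast
    \<comment> \<open>The new letter \<open>a\<close> can cancel only when \<open>p\<close> is
      empty: otherwise it stands in front of the head of \<open>p\<close>, where \<open>u\<close>
      being reduced forbids cancellation.\<close>
    show ?case
    proof (cases "p = [] \<and> q \<noteq> [] \<and> hd q = (fst a, \<not> snd a)")
      case True
      then obtain q' where "q = (fst a, \<not> snd a) # q'" by (cases q) auto
      then show ?thesis using * True
        by (intro exI[of _ "[]"] exI[of _ q'] exI[of _ "a # r"]) (simp add: fg_inv_Cons)
    next
      case False
      have "fg_push a (p @ q) = a # p @ q"
      proof (cases p)
        case Nil
        then show ?thesis using False by (cases q; cases a) auto
      next
        case (Cons b p')
        then show ?thesis using Cons.prems *(1) by (auto simp: fg_reduced_def)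
      qed
      then show ?thesis using *
        by (intro exI[of _ "a # p"] exI[of _ q] exI[of _ r]) simp
    qed
  qed
  then show thesis using that by blast
qed

section \<open>Words that cancel too much when they conjugate a constant\<close>

text \<open>
  If \<open>s \<noteq> []\<close>, then \<open>v\<close> agrees with its own shift by \<open>length p - length q\<close>, a
  periodicity condition that determines it from \<open>c\<close> and \<open>j\<close>.
\<close>

definition fg_overlap :: "('x \<times> bool) list \<Rightarrow> nat \<Rightarrow> nat \<Rightarrow> ('x \<times> bool) list set" where
  "fg_overlap c L j = {v. length v = L \<and> (\<exists>p q s. c = p @ fg_inv q \<and> v = q @ s \<and> length q = j \<and>
     (s = [] \<or> (\<exists>t. v = p @ s @ t) \<or> (\<exists>t. p @ s = v @ t)))}"

text \<open>The length \<open>j\<close> fixes how \<open>c\<close> splits into \<open>p\<close> and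
  \<open>fg_inv q\<close>, so \<open>p\<close> and \<open>q\<close> are common to both words. If
  \<open>s\<close> is empty, the word is \<open>q\<close>. Otherwise strong induction on positions
  applies: each letter is either read off from \<open>q\<close> or \<open>p\<close>, or equals an
  earlier letter of the same word.\<close>

lemma fg_overlap_unique:
  assumes c: "fg_reduced c" "c \<noteq> []" and v: "v \<in> fg_overlap c L j" "v' \<in> fg_overlap c L j"
  shows "v = v'"
proof -
  obtain p q s where 1: "c = p @ fg_inv q" "v = q @ s" "length q = j" "length v = L"
    "s = [] \<or> (\<exists>t. v = p @ s @ t) \<or> (\<exists>t. p @ s = v @ t)"
    using v(1) unfolding fg_overlap_def mem_Collect_eq by blast
  obtain p' q' s' where 2: "c = p' @ fg_inv q'" "v' = q' @ s'" "length q' = j" "length v' = L"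
    "s' = [] \<or> (\<exists>t. v' = p' @ s' @ t) \<or> (\<exists>t. p' @ s' = v' @ t)"
    using v(2) unfolding fg_overlap_def mem_Collect_eq by blast
  have "p @ fg_inv q = p' @ fg_inv q'" using 1 2 by simp
  then have pq: "p' = p" "q' = q"
    using 1(3) 2(3) append_eq_append_conv[of "fg_inv q" "fg_inv q'" p p'] by (auto dest: arg_cong[of _ _ fg_inv])
  have ls: "length s = length s'" using 1 2 by (metis add_left_cancel length_append pq(2))
  show ?thesis
  proof (cases "s = []")
    case True
    then show ?thesis using 1 2 pq ls by simp
  next
    case False
    \<comment> \<open>Whichever of \<open>v\<close> and \<open>p @ s\<close> is a prefix of the
      other, they agree at every position that both have.\<close>
    have shift: "v ! i = (p @ s) ! i" "v' ! i = (p @ s') ! i"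
      if "i < L" "i < length p + length s" for i
    proof -
      have *: "x ! i = y ! i" if "(\<exists>t. x = y @ t) \<or> (\<exists>t. y = x @ t)" "i < length x" "i < length y"
        for x y :: "('a \<times> bool) list"
        using that by (auto simp: nth_append)
      have "(\<exists>t. v = (p @ s) @ t) \<or> (\<exists>t. p @ s = v @ t)"
        using 1(5) False by (simp only: append_assoc) blast
      then show "v ! i = (p @ s) ! i" using * that 1(4) by simp
      have "(\<exists>t. v' = (p @ s') @ t) \<or> (\<exists>t. p @ s' = v' @ t)"
        using 2(5) False ls pq by (simp only: append_assoc) auto
      then show "v' ! i = (p @ s') ! i" using * that 2(4) ls by simp
    qed
    \<comment> \<open>A shift by 0 carries no information about \<open>v\<close>. It would force
      \<open>p = q\<close>, so that \<open>c = q @ fg_inv q\<close>, which is not reduced unless it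
      is empty.\<close>
    have "length p \<noteq> j"
    proof
      assume "length p = j"
      then have "length (p @ s) = length v" using 1 by simp
      moreover obtain t where t: "v = (p @ s) @ t \<or> p @ s = v @ t" using 1(5) False by auto
      ultimately have "length t = 0" using t by (metis add_cancel_right_right length_append)
      then have "v = p @ s" using t by auto
      then have "p = q" using 1(2,3) \<open>length p = j\<close> by (simp add: append_eq_append_conv)
      then show False using fg_reduced_no_cancel[of q] c 1(1) by auto
    qed
    have "i < L \<Longrightarrow> v ! i = v' ! i" for i
    proof (induction i rule: less_induct)
      case (less i)
      have L: "L = j + length s" using 1 by auto
      \<comment> \<open>The first and third cases read the letter from \<open>q\<close> and from
        \<open>p\<close>. In the other two the shift leads to the position \<open>?k\<close>, which
        is smaller than \<open>i\<close>; its formula depends on the sign of the shift.\<close>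
      consider "i < j" | "length p < j" "j \<le> i" | "j < length p" "i < length p" "j \<le> i"
        | "j < length p" "length p \<le> i"
        using \<open>length p \<noteq> j\<close> by linarith
      then show ?case
      proof cases
        case below: 1
        then show ?thesis using 1 2 pq by (simp add: nth_append)
      next
        case shorter: 2
        let ?k = "i - j + length p"
        have "v ! i = v ! ?k" "v' ! i = v' ! ?k"
          using shift[of ?k] shorter 1 2 less.prems L pq by (auto simp: nth_append)
        then show ?thesis using less.IH[of ?k] shorter less.prems by simp
      next
        case 3
        then show ?thesis using shift[of i] less.prems L by (simp add: nth_append)
      next
        case 4
        let ?k = "i - length p + j"
        have "v ! i = v ! ?k" "v' ! i = v' ! ?k"
          using shift[of i] 4 1 2 less.prems L pq by (auto simp: nth_append)
        then show ?thesis using less.IH[of ?k] 4 less.prems by simp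
      qed
    qed
    then show ?thesis using 1(4) 2(4) by (simp add: nth_equalityI)
  qed
qed

text \<open>Write \<open>c v\<close> as \<open>p @ s\<close> and then \<open>z\<close> as
  \<open>p' @ s'\<close>, splitting off what cancels each time. If \<open>s'\<close> were empty,
  \<open>p @ s\<close> would be a prefix of \<open>v\<close>; if \<open>p'\<close> were empty,
  \<open>v\<close> would be a prefix of \<open>p @ s\<close>. Both are overlaps, with
  \<open>j\<close> the number of letters cancelled in \<open>c v\<close>. Hence \<open>z\<close>
  begins with the inverse of the last letter of \<open>v\<close> and ends with that letter.\<close>

lemma fg_conjugate_ends:
  assumes c: "fg_reduced c" and v: "v \<noteq> []" "fg_reduced v"
    and no: "\<And>j. j \<le> length v \<Longrightarrow> v \<notin> fg_overlap c (length v) j"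
  defines "z \<equiv> foldr fg_push (fg_inv v) (foldr fg_push c v)"
  shows "z \<noteq> []" "fst (hd z) = fst (last v)" "fst (last z) = fst (last v)"
proof -
  obtain p s r where 1: "c = p @ r" "v = fg_inv r @ s" "foldr fg_push c v = p @ s"
    using fg_mult_cancellation[OF c] by blast
  obtain p' s' r' where 2: "fg_inv v = p' @ r'" "p @ s = fg_inv r' @ s'" "z = p' @ s'"
    using fg_mult_cancellation[OF fg_reduced_inv[OF v(2)], of "p @ s"] unfolding z_def 1(3) by blast
  have v': "v = fg_inv r' @ fg_inv p'" using 2(1) by (metis fg_inv_append fg_inv_inv)
  have no': "\<not> (s = [] \<or> (\<exists>t. v = p @ s @ t) \<or> (\<exists>t. p @ s = v @ t))"
  proof
    assume "s = [] \<or> (\<exists>t. v = p @ s @ t) \<or> (\<exists>t. p @ s = v @ t)"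
    then have "v \<in> fg_overlap c (length v) (length (fg_inv r))"
      unfolding fg_overlap_def using 1(1,2)
      by (intro CollectI conjI exI[of _ p] exI[of _ "fg_inv r"] exI[of _ s]) simp_all
    then show False using no[of "length (fg_inv r)"] 1(2) by (metis length_append le_add1)
  qed
  have s: "s \<noteq> []" using no' by blast
  have s': "s' \<noteq> []" using no' v' 2(2) by (metis append_Nil2 append_assoc)
  have p': "p' \<noteq> []" using no' v' 2(2) by (metis append_Nil2 fg_inv_Nil)
  show "z \<noteq> []" using 2(3) p' by simp
  show "fst (hd z) = fst (last v)"
    using 2(3) p' v' fst_hd_fg_inv[of "fg_inv p'"] by simp
  have "last s' = last v" using 2(2) 1(2) s s' by (metis last_appendR)
  then show "fst (last z) = fst (last v)" using 2(3) s' by simp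
qed

text \<open>Union bound: each of the \<open>card X * (m + 2)\<close> pairs of a constant
  \<open>c\<close> and an amount \<open>j \<le> Suc m\<close> excludes at most one word, while there
  are \<open>2 ^ m\<close> candidates \<open>u @ [(a, True)]\<close>.\<close>

lemma exists_fg_no_overlap:
  assumes fin: "finite X" and X: "\<And>c. c \<in> X \<Longrightarrow> fg_reduced c \<and> c \<noteq> []"
    and "a \<noteq> b" and small: "card X * (m + 2) < 2 ^ m"
  obtains u where "length u = m" "set u \<subseteq> {(a, True), (b, True)}"
    "\<And>c j. c \<in> X \<Longrightarrow> j \<le> Suc m \<Longrightarrow> u @ [(a, True)] \<notin> fg_overlap c (Suc m) j"
proof -
  let ?U = "{u. set u \<subseteq> {(a, True), (b, True)} \<and> length u = m}"
  let ?f = "\<lambda>u. u @ [(a, True)]"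
  let ?O = "\<lambda>p. fg_overlap (fst p) (Suc m) (snd p)"
  let ?P = "X \<times> {..Suc m}"
  \<comment> \<open>Finiteness is recorded separately, since \<open>card\<close> of an infinite set
    is 0.\<close>
  have sub: "finite (?O p) \<and> card (?O p) \<le> 1" if "p \<in> ?P" for p
  proof -
    have "?O p \<subseteq> {v}" if "v \<in> ?O p" for v
      using fg_overlap_unique[of "fst p" _ "Suc m" "snd p" v] X that \<open>p \<in> ?P\<close> by auto
    then have "?O p = {} \<or> (\<exists>v. ?O p = {v})" by blast
    then show ?thesis by (metis card.empty card_1_singleton_iff finite.simps le_numeral_extra(4) zero_le One_nat_def)
  qed
  have finP: "finite ?P" using fin by simp
  have "card (\<Union>p\<in>?P. ?O p) \<le> (\<Sum>p\<in>?P. card (?O p))" by (rule card_UN_le[OF finP])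
  also have "\<dots> \<le> (\<Sum>p\<in>?P. 1)" using sub by (intro sum_mono) blast
  also have "\<dots> < 2 ^ m" using small by (simp add: card_cartesian_product)
  also have "2 ^ m = card ?U"
    using card_lists_length_eq[of "{(a, True), (b, True)}" m] \<open>a \<noteq> b\<close>
    by (simp add: numeral_2_eq_2)
  also have "\<dots> = card (?f ` ?U)" by (rule card_image[symmetric]) (auto simp: inj_on_def)
  finally have "card (\<Union>p\<in>?P. ?O p) < card (?f ` ?U)" .
  then have "\<not> ?f ` ?U \<subseteq> (\<Union>p\<in>?P. ?O p)"
    using card_mono[of "\<Union>p\<in>?P. ?O p" "?f ` ?U"] finP sub by (meson finite_UN_I linorder_not_le)
  then obtain u where u: "u \<in> ?U" "?f u \<notin> (\<Union>p\<in>?P. ?O p)" by blast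
  then have "?f u \<notin> fg_overlap c (Suc m) j" if "c \<in> X" "j \<le> Suc m" for c j
    using that by force
  then show thesis using that u(1) by blast
qed

section \<open>Inverses, powers and alternating products in the free group\<close>

lemma free_group_simps [simp]:
  "x \<otimes>\<^bsub>free_group B\<^esub> y = foldr fg_push x y" "\<one>\<^bsub>free_group B\<^esub> = []"
  by (simp_all add: free_group_def)

lemma free_group_carrier: "w \<in> carrier (free_group B) \<longleftrightarrow> fst ` set w \<subseteq> B \<and> fg_reduced w"
  by (simp add: free_group_def)

lemma free_group_inv:
  assumes "w \<in> carrier (free_group B)"
  shows "inv\<^bsub>free_group B\<^esub> w = fg_inv w"
proof -
  interpret group "free_group B" by (rule group_free_group)
  have "fg_inv w \<in> carrier (free_group B)"
    using assms fg_reduced_inv by (auto simp: free_group_carrier)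
  then show ?thesis using assms fg_mult_inv[of w]
    by (intro inv_equality) (auto simp: fg_inv_def free_group_carrier)
qed

text \<open>After substitution and conjugation, a block \<open>Inr n\<close> of a normal form
  becomes such a power. All its letters lie over \<open>b\<close>, as the alternation argument
  requires.\<close>

lemma free_group_generator_pow:
  assumes "b \<in> B" and "k \<noteq> 0"
  shows "[(b, True)] [^]\<^bsub>free_group B\<^esub> (k::int) = replicate (nat \<bar>k\<bar>) (b, k > 0)"
proof -
  interpret group "free_group B" by (rule group_free_group)
  have b: "[(b, True)] \<in> carrier (free_group B)"
    using assms by (simp add: free_group_carrier fg_reduced_def)
  have push: "fg_push (b, True) (replicate n (b, True)) = replicate (Suc n) (b, True)" for n
    by (cases n) auto
  have pow: "[(b, True)] [^]\<^bsub>free_group B\<^esub> n = replicate n (b, True)" for n :: nat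
  proof (induction n)
    case (Suc n)
    have "[(b, True)] [^]\<^bsub>free_group B\<^esub> Suc n = [(b, True)] \<otimes>\<^bsub>free_group B\<^esub> ([(b, True)] [^]\<^bsub>free_group B\<^esub> n)"
      by (rule nat_pow_Suc2[OF b])
    then show ?case by (simp only: Suc.IH free_group_simps) (simp add: push)
  qed simp
  have "replicate n (b, True) \<in> carrier (free_group B)" for n
    using nat_pow_closed[OF b, of n] by (simp only: pow)
  then have "inv\<^bsub>free_group B\<^esub> replicate n (b, True) = replicate n (b, False)" for n
    by (simp add: free_group_inv fg_inv_def)
  then show ?thesis using assms(2) by (simp add: int_pow_def2 pow)
qed

text \<open>Neighbouring factors meet in letters over different generators, so the product is a
  plain concatenation. The induction also records the generator of its first letter, which the next
  factor has to avoid.\<close>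

lemma fg_alternating_product_nonempty:
  assumes "\<And>l. l \<in> set w \<Longrightarrow> fg_reduced (f l) \<and> f l \<noteq> [] \<and>
      fst (hd (f l)) = (if isl l then a else b) \<and> fst (last (f l)) = (if isl l then a else b)"
    and "a \<noteq> b" "successively (\<lambda>l m. isl l \<noteq> isl m) w" "w \<noteq> []"
  shows "foldr (\<lambda>l u. foldr fg_push (f l) u) w [] \<noteq> []"
proof -
  let ?R = "\<lambda>w. foldr (\<lambda>l u. foldr fg_push (f l) u) w []"
  have "fg_reduced (?R w) \<and> (w = [] \<or> (?R w \<noteq> [] \<and> fst (hd (?R w)) = (if isl (hd w) then a else b)))"
    using assms(1,3)
  proof (induction w)
    case Nil
    then show ?case by (simp add: fg_reduced_def)
  next
    case (Cons l w)
    have IH: "fg_reduced (?R w)"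
        "w = [] \<or> ?R w \<noteq> [] \<and> fst (hd (?R w)) = (if isl (hd w) then a else b)"
      using Cons by (auto simp: successively_Cons)
    have l: "fg_reduced (f l)" "f l \<noteq> []" "fst (hd (f l)) = (if isl l then a else b)"
        "fst (last (f l)) = (if isl l then a else b)"
      using Cons.prems(1)[of l] by auto
    have "?R w = [] \<or> fst (last (f l)) \<noteq> fst (hd (?R w))"
      using IH(2) l(4) \<open>a \<noteq> b\<close> Cons.prems(2) by (auto simp: successively_Cons)
    then have red: "fg_reduced (f l @ ?R w)"
      using fg_reduced_append[OF l(1) IH(1)] by blast
    show ?case using red l fg_mult_append[OF red] by simp
  qed
  then show ?thesis using \<open>w \<noteq> []\<close> by blast
qed

section \<open>Normal form length versus word length in the free product\<close>

lemma length_fp_push: "length (fp_push G H l w) \<le> Suc (length w)"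
  by (cases "(G, H, l, w)" rule: fp_push.cases) auto

lemma length_fp_mult: "length (foldr (fp_push G H) u v) \<le> length u + length v"
proof (induction u)
  case (Cons l u)
  then show ?case using length_fp_push[of G H l "foldr (fp_push G H) u v"] by simp
qed simp

context group
begin

interpretation A: group "adjoin_var G"
  by (rule group_adjoin_var)

interpretation Z: two_groups G integer_group
  by (intro two_groups.intro is_group group_integer_group)

text \<open>Generators and their inverses have at most one syllable, and lengths of normal forms are
  subadditive. This bounds the number of constants of \<open>w\<close> by \<open>n\<close>.\<close>

lemma length_le_word_length:
  assumes "S \<subseteq> carrier G" "word_length (adjoin_var G) (gens_with_var G S) w \<le> enat n"
  shows "length w \<le> n"
proof -
  let ?A = "adjoin_var G" and ?T = "gens_with_var G S"
  interpret l: group_hom G ?A "fp_inl G"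
    by (intro group_hom.intro group_hom_axioms.intro is_group group_adjoin_var Z.fp_inl_hom)
  interpret i: group_hom integer_group ?A "fp_inr integer_group"
    by (intro group_hom.intro group_hom_axioms.intro group_integer_group group_adjoin_var Z.fp_inr_hom)
  \<comment> \<open>Length 0 occurs when \<open>S\<close> contains the identity, which
    \<open>fp_inl\<close> sends to the empty word.\<close>
  have len: "length t \<le> 1" if "t \<in> ?T \<union> m_inv ?A ` ?T" for t
  proof -
    have "inv\<^bsub>?A\<^esub> free_var = fp_inr integer_group (inv\<^bsub>integer_group\<^esub> 1)"
      unfolding free_var_def by (subst i.hom_inv) auto
    moreover have "inv\<^bsub>?A\<^esub> fp_inl G s = fp_inl G (inv s)" if "s \<in> S" for s
      using l.hom_inv[of s] assms(1) that by auto
    ultimately have "t \<in> range (fp_inl G) \<union> range (fp_inr integer_group)"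
      using that by (auto simp: gens_with_var_def free_var_def)
    then show ?thesis by (auto simp: fp_inl_def fp_inr_def)
  qed
  have *: "length (A.lprod us) \<le> length us" if "set us \<subseteq> ?T \<union> m_inv ?A ` ?T" for us
    using that
  proof (induction us)
    case (Cons u us)
    have "length (A.lprod (u # us)) \<le> length u + length (A.lprod us)"
      using length_fp_mult by simp
    also have "\<dots> \<le> 1 + length us"
      using Cons len[of u] by (intro add_mono) auto
    finally show ?case by simp
  qed simp
  have "word_length ?A ?T w \<noteq> \<infinity>" using assms(2) by (metis enat_ord_simps(5) not_infinity_eq)
  then obtain us where "set us \<subseteq> ?T \<union> m_inv ?A ` ?T" "A.lprod us = w"
      "word_length ?A ?T w = enat (length us)"
    by (rule A.word_length_attained)
  then show ?thesis using *[of us] assms(2) by simp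
qed

end

section \<open>Transport along homomorphisms\<close>

text \<open>Used to carry the value of \<open>w\<close> into the free group syllable by syllable.
  Membership in the carrier is proved along with the equation because \<open>hom_mult\<close> asks
  for it.\<close>

lemma hom_fp_lift:
  assumes K: "group K" and K': "group K'" and h: "h \<in> hom K K'"
    and c: "\<And>l. l \<in> set w \<Longrightarrow> case_sum f g l \<in> carrier K"
  shows "h (fp_lift K f g w) = fp_lift K' (\<lambda>a. h (f a)) (\<lambda>b. h (g b)) w"
proof -
  interpret group_hom K K' h
    using K K' h by (simp add: group_hom_def group_hom_axioms_def)
  have "fp_lift K f g w \<in> carrier K \<and> h (fp_lift K f g w) = fp_lift K' (\<lambda>a. h (f a)) (\<lambda>b. h (g b)) w"
    using c
  proof (induction w)
    case Nil
    then show ?case by (simp add: fp_lift_def)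
  next
    case (Cons l w)
    then have "fp_lift K f g w \<in> carrier K" "case_sum f g l \<in> carrier K"
        "h (fp_lift K f g w) = fp_lift K' (\<lambda>a. h (f a)) (\<lambda>b. h (g b)) w" by auto
    moreover from this have "h (case_sum f g l) = case_sum (\<lambda>a. h (f a)) (\<lambda>b. h (g b)) l"
      by (cases l) auto
    ultimately show ?case by (simp add: fp_lift_def)
  qed
  then show ?thesis by blast
qed

text \<open>A reduced word is the product of its letters, so its image is a product of equally many
  elements of \<open>S\<close> and their inverses. This yields both the generating set and the
  length bound for the substituted element.\<close>

lemma free_group_hom_generated:
  assumes G: "group G" and h: "h \<in> hom (free_group B) G" and w: "w \<in> carrier (free_group B)"
  defines "S \<equiv> (\<lambda>x. h [(x, True)]) ` B"
  shows "h w \<in> generate G S" "word_length G S (h w) \<le> enat (length w)"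
proof -
  interpret F: group "free_group B" by (rule group_free_group)
  interpret group_hom "free_group B" G h
    using F.is_group G h by (simp add: group_hom_def group_hom_axioms_def)
  have "set (map (\<lambda>a. h [a]) w) \<subseteq> S \<union> m_inv G ` S \<and> h w = H.lprod (map (\<lambda>a. h [a]) w)"
    using w
  proof (induction w)
    case Nil
    then show ?case using hom_one by simp
  next
    case (Cons a w)
    have aw: "fst a \<in> B" "w \<in> carrier (free_group B)" "fg_reduced (a # w)"
      using Cons.prems fg_reduced_Cons[of a w] by (auto simp: free_group_carrier)
    have gen: "[(x, s)] \<in> carrier (free_group B)" if "x \<in> B" for x s
      using that by (simp add: free_group_carrier fg_reduced_def)
    have a: "[a] \<in> carrier (free_group B)" using gen[OF aw(1), of "snd a"] by simp
    have "h [a] \<in> S \<union> m_inv G ` S"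
    proof (cases "snd a")
      case True
      then show ?thesis using aw(1) by (cases a) (auto simp: S_def)
    next
      case False
      then have "[a] = inv\<^bsub>free_group B\<^esub> [(fst a, True)]"
        using gen[OF aw(1)] by (cases a) (simp add: free_group_inv fg_inv_def)
      then have "h [a] = inv\<^bsub>G\<^esub> h [(fst a, True)]" using hom_inv gen[OF aw(1)] by simp
      then show ?thesis using aw(1) by (auto simp: S_def)
    qed
    moreover have "h (a # w) = h [a] \<otimes>\<^bsub>G\<^esub> h w"
      using hom_mult[OF a aw(2)] aw(3) by (simp add: fg_push_Cons)
    ultimately show ?case using Cons.IH[OF aw(2)] by simp
  qed
  then have us: "set (map (\<lambda>a. h [a]) w) \<subseteq> S \<union> m_inv G ` S" "H.lprod (map (\<lambda>a. h [a]) w) = h w"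
    by auto
  then show "word_length G S (h w) \<le> enat (length w)"
    using H.word_length_le[OF us] by simp
  have "H.lprod us \<in> generate G S" if "set us \<subseteq> S \<union> m_inv G ` S" for us
    using that
    by (induction us) (auto intro: generate.one generate.incl generate.inv generate.eng)
  then show "h w \<in> generate G S" using us by metis
qed

section \<open>Complexity of a single word\<close>

text \<open>The witness is the image of the conjugate of \<open>b\<close> by a word \<open>v\<close>
  of length \<open>m + 1\<close>, which accounts for
  \<open>2 * m + 3 = 2 * (m + 1) + 1\<close>.\<close>

lemma free_group_mif_complexity:
  assumes G: "group G" and h: "h \<in> iso (free_group B) G"
    and ab: "a \<in> B" "b \<in> B" "a \<noteq> b"
    and w: "w \<in> carrier (adjoin_var G)" "w \<noteq> []" and m: "length w * (m + 2) < 2 ^ m"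
  shows "mif_complexity G ((\<lambda>x. h [(x, True)]) ` B) w \<le> enat (2 * m + 3)"
proof -
  let ?F = "free_group B" and ?S = "(\<lambda>x. h [(x, True)]) ` B"
  interpret F: group ?F by (rule group_free_group)
  interpret G: group G by fact
  define k where "k = inv_into (carrier ?F) h"
  have bij: "bij_betw h (carrier ?F) (carrier G)" and hom: "h \<in> hom ?F G"
    using h by (auto simp: iso_def)
  have hk: "h (k x) = x" if "x \<in> carrier G" for x
    using that bij unfolding k_def by (simp add: bij_betw_inv_into_right)
  have kh: "k (h x) = x" if "x \<in> carrier ?F" for x
    using that bij unfolding k_def by (simp add: bij_betw_inv_into_left)
  have "k \<in> iso G ?F" unfolding k_def by (rule F.iso_set_sym[OF h])
  then have khom: "k \<in> hom G ?F" by (simp add: iso_def)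
  interpret h: group_hom ?F G h
    using F.is_group G hom by (simp add: group_hom_def group_hom_axioms_def)
  interpret k: group_hom G ?F k
    using F.is_group G khom by (simp add: group_hom_def group_hom_axioms_def)
  have letters: "set w \<subseteq> fp_letters G integer_group" and alt: "successively (\<lambda>l m. isl l \<noteq> isl m) w"
    using w(1) by (auto simp: free_product_def)
  \<comment> \<open>The constants of \<open>w\<close> as reduced words. They are nonempty because a
    normal form has no trivial syllables, and there are at most \<open>length w\<close> of
    them.\<close>
  define X where "X = k ` {c. Inl c \<in> set w}"
  have "{c. Inl c \<in> set w} = Inl -` set w" by auto
  then have finX: "finite {c. Inl c \<in> set w}" and "card {c. Inl c \<in> set w} \<le> card (set w)"
    using card_vimage_inj_on_le[of Inl UNIV "set w"] by (auto intro: finite_vimageI)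
  then have "card X \<le> length w"
    unfolding X_def by (meson card_image_le card_length order.trans)
  then have "card X * (m + 2) < 2 ^ m"
    using m by (meson le_less_trans mult_le_mono1)
  moreover have Xr: "c \<in> carrier ?F \<and> fg_reduced c \<and> c \<noteq> []" if "c \<in> X" for c
  proof -
    obtain d where d: "c = k d" "Inl d \<in> set w" using \<open>c \<in> X\<close> by (auto simp: X_def)
    then have "d \<in> carrier G" "d \<noteq> \<one>\<^bsub>G\<^esub>" using letters by (auto simp: fp_letters_def)
    then have "k d \<in> carrier ?F" "k d \<noteq> []" using hk h.hom_one by (auto simp del: hom_one) (metis)
    then show ?thesis using d by (simp add: free_group_carrier)
  qed
  moreover have "finite X" unfolding X_def using finX by simp
  ultimately obtain u where u: "length u = m" "set u \<subseteq> {(a, True), (b, True)}"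
      "\<And>c j. c \<in> X \<Longrightarrow> j \<le> Suc m \<Longrightarrow> u @ [(a, True)] \<notin> fg_overlap c (Suc m) j"
    using exists_fg_no_overlap[of X a b m] \<open>a \<noteq> b\<close> by metis
  define v where "v = u @ [(a, True)]"
  have v: "v \<noteq> []" "length v = Suc m" "fst (last v) = a" "fg_reduced v" "v \<in> carrier ?F"
  proof -
    show red: "fg_reduced v"
      using u(2) by (intro fg_reduced_constant_sign[of _ True]) (auto simp: v_def)
    show "v \<in> carrier ?F" using red u(2) ab by (auto simp: free_group_carrier v_def)
  qed (use u in \<open>auto simp: v_def\<close>)
  define \<beta> where "\<beta> = [(b, True)]"
  have \<beta>: "\<beta> \<in> carrier ?F" using ab by (simp add: \<beta>_def free_group_carrier fg_reduced_def)
  \<comment> \<open>The identification \<open>k\<close> with the free group followed by conjugation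
    by the inverse of \<open>v\<close>. A value of \<open>w\<close> is nontrivial once its image
    under \<kappa> is nonempty.\<close>
  define \<kappa> where "\<kappa> = (\<lambda>x. inv\<^bsub>?F\<^esub> v \<otimes>\<^bsub>?F\<^esub> (k x \<otimes>\<^bsub>?F\<^esub> v))"
  have "\<kappa> \<in> hom G ?F"
  proof (rule homI)
    fix x y assume xy: "x \<in> carrier G" "y \<in> carrier G"
    show "\<kappa> x \<in> carrier ?F" unfolding \<kappa>_def using xy v by (intro F.m_closed) auto
    have "v \<otimes>\<^bsub>?F\<^esub> (inv\<^bsub>?F\<^esub> v \<otimes>\<^bsub>?F\<^esub> z) = z" if "z \<in> carrier ?F" for z
      using that v(5) F.m_assoc[of v "inv\<^bsub>?F\<^esub> v" z] by (simp del: free_group_simps)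
    then show "\<kappa> (x \<otimes>\<^bsub>G\<^esub> y) = \<kappa> x \<otimes>\<^bsub>?F\<^esub> \<kappa> y"
      using xy v(5) by (simp add: \<kappa>_def F.m_assoc del: free_group_simps)
  qed
  then interpret \<kappa>: group_hom G ?F \<kappa>
    using F.is_group G by (simp add: group_hom_def group_hom_axioms_def)
  \<comment> \<open>Chosen so that \<kappa> undoes the conjugation and sends \<open>g\<close> to the
    single letter \<beta>.\<close>
  define g where "g = h (v \<otimes>\<^bsub>?F\<^esub> \<beta> \<otimes>\<^bsub>?F\<^esub> inv\<^bsub>?F\<^esub> v)"
  have gF: "v \<otimes>\<^bsub>?F\<^esub> \<beta> \<otimes>\<^bsub>?F\<^esub> inv\<^bsub>?F\<^esub> v \<in> carrier ?F" using v \<beta> by (intro F.m_closed) auto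
  then have g: "g \<in> carrier G" unfolding g_def by (rule h.hom_closed)
  have "\<kappa> g = \<beta>"
  proof -
    have "inv\<^bsub>?F\<^esub> v \<otimes>\<^bsub>?F\<^esub> (v \<otimes>\<^bsub>?F\<^esub> z) = z" if "z \<in> carrier ?F" for z
      using that v(5) F.m_assoc[of "inv\<^bsub>?F\<^esub> v" v z] by (simp del: free_group_simps)
    then show ?thesis
      using v(5) \<beta> kh[OF gF] by (simp add: \<kappa>_def g_def F.m_assoc del: free_group_simps)
  qed
  let ?f = "case_sum \<kappa> (\<lambda>n. \<kappa> (g [^]\<^bsub>G\<^esub> (n::int)))"
  have "\<kappa> (eval_word G w g) = fp_lift ?F \<kappa> (\<lambda>n. \<kappa> (g [^]\<^bsub>G\<^esub> n)) w"
    unfolding eval_word_def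
    by (rule hom_fp_lift[OF G F.is_group \<kappa>.homh])
      (use letters g in \<open>auto simp: fp_letters_def G.int_pow_closed split: sum.split\<close>)
  also have "\<dots> = foldr (\<lambda>l u. foldr fg_push (?f l) u) w []"
    by (simp add: fp_lift_def)
  also have "\<dots> \<noteq> []"
  proof (rule fg_alternating_product_nonempty[OF _ ab(3) alt w(2)])
    fix l assume l: "l \<in> set w"
    show "fg_reduced (?f l) \<and> ?f l \<noteq> [] \<and> fst (hd (?f l)) = (if isl l then a else b) \<and>
        fst (last (?f l)) = (if isl l then a else b)"
    proof (cases l)
      case (Inl c)
      then have c: "k c \<in> X" "c \<in> carrier G" using l letters by (auto simp: X_def fp_letters_def)
      have "\<kappa> c = foldr fg_push (fg_inv v) (foldr fg_push (k c) v)"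
        using v(5) by (simp add: \<kappa>_def free_group_inv)
      moreover have "fg_reduced (\<kappa> c)" using \<kappa>.hom_closed[OF c(2)] by (simp add: free_group_carrier)
      moreover have "v \<notin> fg_overlap (k c) (length v) j" if "j \<le> length v" for j
        using that u(3)[OF c(1)] v(2) by (simp add: v_def)
      ultimately show ?thesis
        using fg_conjugate_ends[of "k c" v] Xr[OF c(1)] v Inl by simp
    next
      case (Inr n)
      then have n: "n \<noteq> 0" using l letters by (auto simp: fp_letters_def)
      have "?f l = replicate (nat \<bar>n\<bar>) (b, n > 0)"
        using Inr \<kappa>.hom_int_pow[OF g, of n] \<open>\<kappa> g = \<beta>\<close> free_group_generator_pow[OF ab(2) n]
        by (simp add: \<beta>_def)
      moreover obtain N where "nat \<bar>n\<bar> = Suc N" using n by (cases "nat \<bar>n\<bar>") auto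
      ultimately obtain s where f: "?f l = replicate (Suc N) (b, s)" by metis
      have "fg_reduced (replicate (Suc N) (b, s))"
        by (rule fg_reduced_constant_sign[of _ s]) auto
      moreover have "last (replicate (Suc N) (b, s)) = (b, s)" by (rule last_replicate) simp
      moreover have "\<not> isl l" using Inr by simp
      ultimately show ?thesis unfolding f by simp
    qed
  qed
  finally have "eval_word G w g \<noteq> \<one>\<^bsub>G\<^esub>" using \<kappa>.hom_one by auto
  then have "mif_complexity G ?S w \<le> word_length G ?S g"
    unfolding mif_complexity_def using g by (intro INF_lower) auto
  also have "\<dots> \<le> enat (2 * m + 3)"
  proof -
    have Sc: "?S \<subseteq> carrier G"
      by (auto intro!: h.hom_closed simp: free_group_carrier fg_reduced_def)
    have hv: "word_length G ?S (h v) \<le> enat (Suc m)"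
      using free_group_hom_generated(2)[OF G hom v(5)] v(2) by simp
    have hb: "word_length G ?S (h \<beta>) \<le> enat 1"
      using free_group_hom_generated(2)[OF G hom \<beta>] by (simp add: \<beta>_def)
    have "g = h v \<otimes>\<^bsub>G\<^esub> h \<beta> \<otimes>\<^bsub>G\<^esub> inv\<^bsub>G\<^esub> h v"
      unfolding g_def using v(5) \<beta> by (simp del: free_group_simps)
    then have "word_length G ?S g \<le>
        word_length G ?S (h v \<otimes>\<^bsub>G\<^esub> h \<beta>) + word_length G ?S (inv\<^bsub>G\<^esub> h v)"
      by (simp only:) (rule G.word_length_mult[OF Sc])
    also have "\<dots> \<le>
        word_length G ?S (h v) + word_length G ?S (h \<beta>) + word_length G ?S (inv\<^bsub>G\<^esub> h v)"
      by (intro add_right_mono G.word_length_mult[OF Sc])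
    also have "\<dots> \<le> enat (Suc m) + enat 1 + enat (Suc m)"
      by (intro add_mono hv hb order.trans[OF G.word_length_inv[OF Sc]])
    also have "\<dots> = enat (2 * m + 3)" by simp
    finally show ?thesis .
  qed
  finally show ?thesis .
qed

section \<open>From the complexity bound to logarithmic growth\<close>

theorem corollary1p3:
  fixes G :: "('a, 'm) monoid_scheme" and B :: "'x set"
  assumes "group G"
    and "finite B" and "card B \<ge> 2"
    and "G \<cong> free_group B"
  shows "sharply_MIF G"
proof -
  let ?F = "free_group B"
  interpret G: group G by fact
  obtain h where h: "h \<in> iso ?F G"
    using G.iso_sym[OF assms(4)] by (auto simp: is_iso_def)
  obtain a b where ab: "a \<in> B" "b \<in> B" "a \<noteq> b"
    using assms(3) by (metis card_2_iff insert_subset obtain_subset_with_card_n)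
  define S where "S = (\<lambda>x. h [(x, True)]) ` B"
  have hom: "h \<in> hom ?F G" and surj: "h ` carrier ?F = carrier G"
    using h by (auto simp: iso_def bij_betw_def)
  have Sc: "S \<subseteq> carrier G"
    using surj by (auto simp: S_def free_group_carrier fg_reduced_def)
  have "carrier G \<subseteq> generate G S"
    unfolding S_def surj[symmetric] by (intro image_subsetI free_group_hom_generated(1)[OF assms(1) hom])
  then have S: "finite_gen_set G S"
    using G.generate_incl[OF Sc] Sc assms(2) by (auto simp: finite_gen_set_def S_def)
  \<comment> \<open>With \<open>m = 2 * k + 3\<close> the bound \<open>2 * m + 3\<close> equals
    \<open>4 * k + 9\<close>. As \<open>k \<le> log 2 n + 1\<close> and
    \<open>log 2 n \<ge> 1\<close>, it is at most
    \<open>4 * log 2 n + 13 \<le> 17 * log 2 n\<close>.\<close>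
  have "ereal_of_enat (mif_growth G S n) \<le> ereal (17 / ln 2 * ln (real n))" if n: "n \<ge> 2" for n
  proof -
    define k where "k = nat \<lceil>log 2 (real n)\<rceil>"
    have log: "log 2 (real n) \<ge> 1" using n by simp
    have k: "log 2 (real n) \<le> real k" "real k \<le> log 2 (real n) + 1"
      unfolding k_def using log by linarith+
    have "real n = 2 powr log 2 (real n)" using n by simp
    also have "\<dots> \<le> 2 powr real k" using k(1) by simp
    finally have nk: "n \<le> 2 ^ k" by (simp add: powr_realpow of_nat_le_iff flip: of_nat_power)
    \<comment> \<open>One factor \<open>2 ^ k\<close> of the right-hand side absorbs
      \<open>n\<close>, and the remaining \<open>8 * 2 ^ k\<close> absorbs
      \<open>m + 2 = 2 * k + 5\<close>.\<close>
    have small: "n * (2 * k + 3 + 2) < 2 ^ (2 * k + 3)"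
    proof -
      have "2 * k + 5 < 8 * 2 ^ k" by (induction k) auto
      then have "n * (2 * k + 5) < 2 ^ k * (8 * 2 ^ k)"
        using nk n by (intro mult_le_less_imp_less) auto
      moreover have "(2::nat) ^ (2 * k) = 2 ^ k * 2 ^ k" by (simp only: mult_2 power_add)
      ultimately show ?thesis by (simp add: power_add algebra_simps)
    qed
    have "mif_growth G S n \<le> enat (2 * (2 * k + 3) + 3)"
      unfolding mif_growth_def
    proof (rule SUP_least)
      fix w assume "w \<in> {w \<in> carrier (adjoin_var G). w \<noteq> \<one>\<^bsub>adjoin_var G\<^esub> \<and>
        word_length (adjoin_var G) (gens_with_var G S) w \<le> enat n}"
      then have w: "w \<in> carrier (adjoin_var G)" "w \<noteq> []" "length w \<le> n"
        using G.length_le_word_length[OF Sc] by auto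
      have "length w * (2 * k + 3 + 2) < 2 ^ (2 * k + 3)"
        using small w(3) by (meson le_less_trans mult_le_mono1)
      then show "mif_complexity G S w \<le> enat (2 * (2 * k + 3) + 3)"
        unfolding S_def by (rule free_group_mif_complexity[OF assms(1) h ab w(1,2)])
    qed
    then have "ereal_of_enat (mif_growth G S n) \<le> ereal (real (2 * (2 * k + 3) + 3))"
      by (cases "mif_growth G S n") auto
    also have "\<dots> \<le> ereal (17 * log 2 (real n))" using k(2) log by simp
    finally show ?thesis by (simp add: log_def)
  qed
  then have "sharply_MIF_wrt G S"
    unfolding sharply_MIF_wrt_def by (intro exI[of _ "17 / ln 2"]) auto
  then show ?thesis using S unfolding sharply_MIF_def by blast
qed

end
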